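(* Let $a,b$ be real numbers and $0\le\varphi\le\frac{\pi}{2}$ be such that $a<a+e^{i\varphi}(b-a)$, let $K=[a,a+e^{i\varphi}(b-a)]$, and suppose $a,b\in K$. Let $f:K\to(0,\infty)$ be differentiable on $K$ (one-sided derivatives at the endpoints), and let $p\in\mathbb{R}$ with $p>1$. If $|f'|^{\frac{p}{p-1}}$ is $\varphi$-convex on $K$, then $$\left|\frac{1}{e^{i\varphi}(b-a)}\int_a^{a+e^{i\varphi}(b-a)}f(x)\,dx-f\left(\frac{2a+e^{i\varphi}(b-a)}{2}\right)\right|\le\frac{e^{i\varphi}(b-a)}{4}\left(\frac{4}{p+1}\right)^{\frac1p}\left[|f'(a)|+|f'(b)|\right].$$
   Context: $\varphi$ is a fixed real number with $0\le\varphi\le\frac{\pi}{2}$. The condition $a<a+e^{i\varphi}(b-a)$ is understood to mean that $e^{i\varphi}(b-a)$ is a (strictly) positive real number, so that $K=[a,a+e^{i\varphi}(b-a)]$ is an interval of real numbers. A set $K$ is $\varphi$-convex if $u+te^{i\varphi}(v-u)\in K$ for all $u,v\in K$ and $t\in[0,1]$; $K$ is assumed to be $\varphi$-convex. A real function $g$ on a $\varphi$-convex set $K$ is $\varphi$-convex if $g(u+te^{i\varphi}(v-u))\le(1-t)g(u)+tg(v)$ for all $u,v\in K$ and $t\in[0,1]$. *)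

theory Defs
  imports "HOL-Analysis.Analysis"
begin

definition phi_diff :: "real \<Rightarrow> real \<Rightarrow> real \<Rightarrow> complex" where
  "phi_diff \<phi> u v = exp (\<i> * complex_of_real \<phi>) * complex_of_real (v - u)"

definition phi_point :: "real \<Rightarrow> real \<Rightarrow> real \<Rightarrow> real \<Rightarrow> complex" where
  "phi_point \<phi> u v t = complex_of_real u + complex_of_real t * phi_diff \<phi> u v"

text \<open>
  The point u + t exp(i phi) (v - u) is a priori a complex number. For a set K of reals,
  phi-convexity requires that it be real and lie in K.
\<close>

definition phi_convex_set :: "real \<Rightarrow> real set \<Rightarrow> bool" where
  "phi_convex_set \<phi> K \<longleftrightarrow>
     (\<forall>u\<in>K. \<forall>v\<in>K. \<forall>t\<in>{0..1}. phi_point \<phi> u v t \<in> complex_of_real ` K)"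

text \<open>
  Since K is phi-convex, the points below are real, so taking the real part only turns an
  element of the image of K in the complex numbers back into the element of K itself.
\<close>

definition phi_convex_on :: "real \<Rightarrow> real set \<Rightarrow> (real \<Rightarrow> real) \<Rightarrow> bool" where
  "phi_convex_on \<phi> K g \<longleftrightarrow>
     phi_convex_set \<phi> K \<and>
     (\<forall>u\<in>K. \<forall>v\<in>K. \<forall>t\<in>{0..1}.
        g (Re (phi_point \<phi> u v t)) \<le> (1 - t) * g u + t * g v)"

end

theory Submission
  imports Defs
begin

text \<open>
  Since \<open>exp (\<i> \<phi>) (b - a)\<close> is real and positive while \<open>b \<ge> a\<close> (as \<open>b \<in> K\<close>), the factor
  \<open>exp (\<i> \<phi>)\<close> is a positive real number of modulus one, hence equal to \<open>1\<close>. The theorem is therefore a statement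
  about an ordinary interval \<open>[a, b]\<close> and an ordinary convex function \<open>\<bar>f'\<bar>\<^sup>q\<close>,
  where \<open>1 / p + 1 / q = 1\<close>.

  The deviation of the mean value of \<open>f\<close> from the value at the midpoint \<open>m\<close> is controlled by
  symmetrisation. The function \<open>w x = f x + f (a + b - x)\<close> has twice the integral of \<open>f\<close> and
  satisfies \<open>w m = 2 f m\<close>; if \<open>\<bar>f' x\<bar> + \<bar>f' (a + b - x)\<bar> \<le> D\<close> throughout, the mean value
  inequality gives \<open>\<bar>w x - w m\<bar> \<le> D \<bar>x - m\<bar>\<close>, and integrating this bounds the deviation by
  \<open>D (b - a) / 8\<close> (\<open>midpoint_deviation_bound\<close>).

  A suitable \<open>D\<close> comes from convexity. Adding the convexity inequalities at the mirror points
  \<open>x\<close> and \<open>a + b - x\<close> eliminates the weights: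
  \<open>\<bar>f' x\<bar>\<^sup>q + \<bar>f' (a + b - x)\<bar>\<^sup>q \<le> \<bar>f' a\<bar>\<^sup>q + \<bar>f' b\<bar>\<^sup>q\<close>. The power mean inequality on the left and
  superadditivity of \<open>t\<^sup>q\<close> on the right turn this into \<open>D = 2\<^bsup>1/p\<^esup> (\<bar>f' a\<bar> + \<bar>f' b\<bar>)\<close>
  (\<open>add_le_of_powr_add_le\<close>). The resulting constant \<open>2\<^bsup>1/p\<^esup> / 8\<close> does not exceed
  \<open>(4 / (p + 1))\<^bsup>1/p\<^esup> / 4\<close>, because this amounts to \<open>p + 1 \<le> 2\<^bsup>p + 1\<^esup>\<close>.
\<close>

lemma powr_midpoint_le:
  fixes u v q :: real
  assumes "0 \<le> u" "0 \<le> v" "1 \<le> q"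
  shows "((u + v) / 2) powr q \<le> (u powr q + v powr q) / 2"
proof -
  \<comment> \<open>\<open>powr_convex\<close> covers only the open half-line, so arguments equal to \<open>0\<close> are treated apart.\<close>
  have half: "(x / 2) powr q \<le> x powr q / 2" if "0 \<le> x" for x :: real
  proof -
    have "(2::real) powr 1 \<le> 2 powr q"
      using assms by (intro powr_mono) auto
    then have "x powr q / 2 powr q \<le> x powr q / 2"
      by (intro divide_left_mono) auto
    then show ?thesis
      using that by (simp add: powr_divide)
  qed
  show ?thesis
  proof (cases "u = 0 \<or> v = 0")
    case True
    then show ?thesis
      using half[of u] half[of v] assms by auto
  next
    case False
    then have "u \<in> {0<..}" "v \<in> {0<..}"
      using assms by auto
    from convex_onD[OF powr_convex[OF assms(3)] _ _ this, of "1/2"]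
    show ?thesis
      by (simp add: field_simps)
  qed
qed

lemma powr_superadditive:
  fixes x y q :: real
  assumes "0 \<le> x" "0 \<le> y" "1 \<le> q"
  shows "x powr q + y powr q \<le> (x + y) powr q"
proof (cases "x + y = 0")
  case True
  then have "x = 0" "y = 0"
    using assms by auto
  then show ?thesis
    by simp
next
  case False
  define s where "s = x + y"
  have s: "0 < s"
    using False assms by (simp add: s_def)
  have part: "z powr q \<le> (z / s) * s powr q" if "0 \<le> z" "z \<le> s" for z
  proof -
    have "(z / s) powr q \<le> (z / s) powr 1"
      using that s assms by (intro powr_mono') auto
    then show ?thesis
      using that s by (simp add: powr_divide field_simps)
  qed
  have "x powr q + y powr q \<le> (x / s) * s powr q + (y / s) * s powr q"
    using part[of x] part[of y] assms by (simp add: s_def)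
  also have "\<dots> = s powr q"
    using s by (simp add: s_def add_divide_distrib[symmetric] flip: distrib_right)
  finally show ?thesis
    by (simp add: s_def)
qed

text \<open>
  Raising to the power \<open>1 / q\<close> in \<open>((u + v) / 2)\<^sup>q \<le> (u\<^sup>q + v\<^sup>q) / 2 \<le> (x + y)\<^sup>q / 2\<close> leaves the
  factor \<open>2 \<cdot> 2\<^bsup>-1/q\<^esup>\<close>, which is \<open>2\<^bsup>1/p\<^esup>\<close> for the conjugate exponent \<open>p\<close>.
\<close>

lemma add_le_of_powr_add_le:
  fixes u v x y q :: real
  assumes "0 \<le> u" "0 \<le> v" "0 \<le> x" "0 \<le> y" "1 \<le> q"
    and le: "u powr q + v powr q \<le> x powr q + y powr q"
  shows "u + v \<le> 2 powr (1 - 1 / q) * (x + y)"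
proof -
  have "((u + v) / 2) powr q \<le> (u powr q + v powr q) / 2"
    using assms by (intro powr_midpoint_le)
  also have "\<dots> \<le> (x + y) powr q / 2"
    using powr_superadditive[OF assms(3-5)] le by simp
  finally have "((u + v) / 2) powr q \<le> (x + y) powr q / 2" .
  then have "(((u + v) / 2) powr q) powr (1 / q) \<le> ((x + y) powr q / 2) powr (1 / q)"
    using assms by (intro powr_mono2) auto
  then have "(u + v) / 2 \<le> (x + y) / 2 powr (1 / q)"
    using assms by (simp add: powr_powr powr_divide)
  then show ?thesis
    by (simp add: powr_diff field_simps)
qed

lemma integral_reflect_Icc:
  fixes f :: "real \<Rightarrow> real"
  shows "integral {a..b} (\<lambda>x. f (a + b - x)) = integral {a..b} f"
proof -
  have "integral {a..b} f = integral {-b..-a} (\<lambda>x. f (- x))"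
    by simp
  also have "\<dots> = integral {-b + (a + b)..-a + (a + b)} (\<lambda>x. f (a + b - x))"
    using integral_shift_real_ivl[of "-b + (a + b)" "a + b" "-a + (a + b)" "\<lambda>x. f (a + b - x)"]
    by simp
  finally show ?thesis
    by simp
qed

lemma has_integral_abs_minus_midpoint:
  fixes a b :: real
  assumes "a \<le> b"
  shows "((\<lambda>x. \<bar>x - (a + b) / 2\<bar>) has_integral (b - a)\<^sup>2 / 4) {a..b}"
proof -
  define m where "m = (a + b) / 2"
  have m: "a \<le> m" "m \<le> b"
    using assms by (auto simp: m_def)
  have "((\<lambda>x. m - x) has_integral (- (m - m)\<^sup>2 / 2) - (- (m - a)\<^sup>2 / 2)) {a..m}"
    using m(1)
    by (intro fundamental_theorem_of_calculus)
      (auto intro!: derivative_eq_intros simp: field_simps simp flip: has_real_derivative_iff_has_vector_derivative)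
  then have left: "((\<lambda>x. \<bar>x - m\<bar>) has_integral (m - a)\<^sup>2 / 2) {a..m}"
    by (subst has_integral_cong[where g = "\<lambda>x. m - x"]) auto
  have "((\<lambda>x. x - m) has_integral ((b - m)\<^sup>2 / 2) - ((m - m)\<^sup>2 / 2)) {m..b}"
    using m(2)
    by (intro fundamental_theorem_of_calculus)
      (auto intro!: derivative_eq_intros simp: field_simps simp flip: has_real_derivative_iff_has_vector_derivative)
  then have right: "((\<lambda>x. \<bar>x - m\<bar>) has_integral (b - m)\<^sup>2 / 2) {m..b}"
    by (subst has_integral_cong[where g = "\<lambda>x. x - m"]) auto
  have total: "(m - a)\<^sup>2 / 2 + (b - m)\<^sup>2 / 2 = (b - a)\<^sup>2 / 4"
    by (simp add: m_def field_simps power2_eq_square)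
  then show ?thesis
    using has_integral_combine[OF m left right] unfolding total by (simp only: m_def)
qed

text \<open>
  The symmetrised function \<open>w x = f x + f (a + b - x)\<close> has derivative
  \<open>f' x - f' (a + b - x)\<close>, so a joint bound on \<open>f'\<close> at mirror points makes it Lipschitz with
  constant \<open>D\<close>; the deviation is at most \<open>D / 2\<close> times \<open>\<integral> \<bar>x - m\<bar> dx = (b - a)\<^sup>2 / 4\<close> divided by
  \<open>b - a\<close>. Stating the hypothesis for mirror points together matters, because convexity of a
  power of \<open>\<bar>f'\<bar>\<close> controls that sum better than twice its largest term.
\<close>

lemma midpoint_deviation_bound:
  fixes f f' :: "real \<Rightarrow> real"
  assumes "a < b"
    and deriv: "\<And>x. x \<in> {a..b} \<Longrightarrow> (f has_real_derivative f' x) (at x within {a..b})"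
    and bound: "\<And>x. x \<in> {a..b} \<Longrightarrow> \<bar>f' x\<bar> + \<bar>f' (a + b - x)\<bar> \<le> D"
  shows "\<bar>1 / (b - a) * integral {a..b} f - f ((a + b) / 2)\<bar> \<le> D * (b - a) / 8"
proof -
  define m where "m = (a + b) / 2"
  define w where "w = (\<lambda>x. f x + f (a + b - x))"
  have m: "m \<in> {a..b}"
    using assms(1) by (auto simp: m_def)
  have refl: "(\<lambda>x. a + b - x) ` {a..b} = {a..b}"
    by simp
  have dw: "(w has_real_derivative f' x - f' (a + b - x)) (at x within {a..b})"
    if x: "x \<in> {a..b}" for x
  proof -
    have "a + b - x \<in> {a..b}"
      using x by auto
    then have "(f has_real_derivative f' (a + b - x))
        (at (a + b - x) within (\<lambda>x. a + b - x) ` {a..b})"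
      unfolding refl by (rule deriv)
    moreover have "((\<lambda>x. a + b - x) has_real_derivative -1) (at x within {a..b})"
      by (auto intro!: derivative_eq_intros)
    ultimately have "(f \<circ> (\<lambda>x. a + b - x) has_real_derivative f' (a + b - x) * -1)
        (at x within {a..b})"
      by (rule DERIV_image_chain)
    from DERIV_add[OF deriv[OF x] this] show ?thesis
      by (simp add: w_def o_def)
  qed
  have lipschitz: "\<bar>w x - w m\<bar> \<le> D * \<bar>x - m\<bar>" if "x \<in> {a..b}" for x
  proof -
    have "norm (w x - w m) \<le> D * norm (x - m)"
      using that m bound
      by (intro field_differentiable_bound[OF _ dw])
        (auto intro: order_trans[OF abs_triangle_ineq4])
    then show ?thesis
      by simp
  qed
  have cont_f: "continuous_on {a..b} f"
    using deriv by (rule DERIV_continuous_on)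
  have int_refl: "(\<lambda>x. f (a + b - x)) integrable_on {a..b}"
    by (intro integrable_continuous_real continuous_on_compose2[OF cont_f] continuous_intros)
      auto
  have int_f: "f integrable_on {a..b}"
    using cont_f by (rule integrable_continuous_real)
  have w_integral: "(w has_integral 2 * integral {a..b} f) {a..b}"
    using has_integral_add[OF integrable_integral[OF int_f] integrable_integral[OF int_refl]]
    by (simp add: w_def integral_reflect_Icc)
  have const: "((\<lambda>x. w m) has_integral (b - a) * w m) {a..b}"
    using has_integral_const_real[of "w m" a b] assms(1) by simp
  have diff: "((\<lambda>x. w x - w m) has_integral 2 * integral {a..b} f - (b - a) * w m) {a..b}"
    using w_integral const by (rule has_integral_diff)
  have abs: "((\<lambda>x. D * \<bar>x - m\<bar>) has_integral D * ((b - a)\<^sup>2 / 4)) {a..b}"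
    unfolding m_def
    using has_integral_abs_minus_midpoint assms(1) by (intro has_integral_mult_right) auto
  have "norm (integral {a..b} (\<lambda>x. w x - w m)) \<le> integral {a..b} (\<lambda>x. D * \<bar>x - m\<bar>)"
    using diff abs lipschitz by (intro integral_norm_bound_integral) auto
  then have main: "\<bar>2 * integral {a..b} f - (b - a) * w m\<bar> \<le> D * ((b - a)\<^sup>2 / 4)"
    unfolding integral_unique[OF diff] integral_unique[OF abs] by simp
  have "w m = 2 * f m"
    by (simp add: w_def m_def add_divide_distrib)
  then have "2 * integral {a..b} f - (b - a) * w m
      = (2 * (b - a)) * (1 / (b - a) * integral {a..b} f - f m)"
    using assms(1) by (simp add: field_simps)
  then have "\<bar>2 * integral {a..b} f - (b - a) * w m\<bar>
      = (2 * (b - a)) * \<bar>1 / (b - a) * integral {a..b} f - f m\<bar>"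
    using assms(1) by (simp only: abs_mult)
  moreover have "D * ((b - a)\<^sup>2 / 4) = (2 * (b - a)) * (D * (b - a) / 8)"
    by (simp add: power2_eq_square)
  ultimately have "(2 * (b - a)) * \<bar>1 / (b - a) * integral {a..b} f - f m\<bar>
      \<le> (2 * (b - a)) * (D * (b - a) / 8)"
    using main by (simp only:)
  moreover have "0 < 2 * (b - a)"
    using assms(1) by simp
  ultimately show ?thesis
    unfolding m_def by (simp only: mult_le_cancel_left_pos)
qed

text \<open>
  After taking \<open>p\<close>-th powers the claim reads \<open>p + 1 \<le> 2\<^bsup>p + 1\<^esup>\<close>, which follows from
  \<open>exp x \<ge> 1 + x\<close> and \<open>ln 2 \<ge> 1 / 2\<close>.
\<close>

lemma two_powr_le_twice_four_div_powr:
  fixes p :: real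
  assumes "0 < p"
  shows "2 powr (1 / p) \<le> 2 * (4 / (p + 1)) powr (1 / p)"
proof -
  have "1 + p * ln 2 \<le> 2 powr p"
    using exp_ge_add_one_self[of "p * ln 2"] by (simp add: powr_def)
  moreover have "p * (1 / 2) \<le> p * ln 2"
    using ln2_ge_two_thirds assms by (intro mult_left_mono) auto
  ultimately have "p + 1 \<le> 2 * 2 powr p"
    by linarith
  then have "2 \<le> 2 powr p * (4 / (p + 1))"
    using assms by (simp add: field_simps)
  then have "2 powr (1 / p) \<le> (2 powr p * (4 / (p + 1))) powr (1 / p)"
    using assms by (intro powr_mono2) auto
  also have "\<dots> = 2 * (4 / (p + 1)) powr (1 / p)"
    using assms by (subst powr_mult) (auto simp: powr_powr)
  finally show ?thesis .
qed

text \<open>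
  Comparing moduli gives \<open>h = \<bar>b - a\<bar> = b - a\<close>, and cancelling that common factor gives the rest.
\<close>

lemma rotation_trivial:
  assumes rot: "complex_of_real h = exp (\<i> * complex_of_real \<phi>) * complex_of_real (b - a)"
    and "0 < h" "a \<le> b"
  shows "h = b - a" and "exp (\<i> * complex_of_real \<phi>) = 1"
proof -
  have "norm (complex_of_real h) = norm (complex_of_real (b - a))"
    unfolding rot by (simp add: norm_mult)
  then show h: "h = b - a"
    using assms(2,3) by (simp del: of_real_diff)
  have "complex_of_real h \<noteq> 0"
    using assms(2) by simp
  then show "exp (\<i> * complex_of_real \<phi>) = 1"
    using rot unfolding h by (metis mult_cancel_right1)
qed

theorem theorem2p6:
  fixes a b \<phi> p h :: real and K :: "real set" and f f' :: "real \<Rightarrow> real"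
  assumes "0 \<le> \<phi>" and "\<phi> \<le> pi / 2"
    and "complex_of_real h = exp (\<i> * complex_of_real \<phi>) * complex_of_real (b - a)"
    and "a < a + h"
    and "K = {a..a + h}"
    and "phi_convex_set \<phi> K"
    and "a \<in> K" and "b \<in> K"
    and "\<And>x. x \<in> K \<Longrightarrow> 0 < f x"
    and "\<And>x. x \<in> K \<Longrightarrow> (f has_real_derivative f' x) (at x within K)"
    and "1 < p"
    and "phi_convex_on \<phi> K (\<lambda>x. \<bar>f' x\<bar> powr (p / (p - 1)))"
  shows "\<bar>(1 / h) * integral {a..a + h} f - f ((2 * a + h) / 2)\<bar>
           \<le> h / 4 * (4 / (p + 1)) powr (1 / p) * (\<bar>f' a\<bar> + \<bar>f' b\<bar>)"
proof -
  have "0 < h" "a \<le> b"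
    using assms(4,5,8) by auto
  note rot = rotation_trivial[OF assms(3) this]
  have h: "h = b - a"
    by (rule rot(1))
  have ab: "a < b" and K: "K = {a..b}"
    using \<open>0 < h\<close> assms(5) by (auto simp: h)
  define q where "q = p / (p - 1)"
  have q: "1 \<le> q" "1 - 1 / q = 1 / p"
    using assms(11) by (auto simp: q_def field_simps)
  have point: "Re (phi_point \<phi> a b t) = a + t * (b - a)" for t
    by (simp add: phi_point_def phi_diff_def rot(2))
  have conv: "\<bar>f' (a + t * (b - a))\<bar> powr q \<le> (1 - t) * \<bar>f' a\<bar> powr q + t * \<bar>f' b\<bar> powr q"
    if "t \<in> {0..1}" for t
    using assms(7,8,12) that unfolding phi_convex_on_def q_def
    by (metis (no_types, lifting) point)
  have sum_bound: "\<bar>f' x\<bar> + \<bar>f' (a + b - x)\<bar> \<le> 2 powr (1 / p) * (\<bar>f' a\<bar> + \<bar>f' b\<bar>)"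
    if x: "x \<in> {a..b}" for x
  proof -
    define t where "t = (x - a) / (b - a)"
    have t: "t \<in> {0..1}" "1 - t \<in> {0..1}"
      using x ab by (auto simp: t_def)
    have "t * (b - a) = x - a"
      using ab by (simp add: t_def)
    then have x_eq: "x = a + t * (b - a)" and mirror_eq: "a + b - x = a + (1 - t) * (b - a)"
      by (simp_all add: algebra_simps)
    have "\<bar>f' x\<bar> powr q + \<bar>f' (a + b - x)\<bar> powr q
        \<le> ((1 - t) * \<bar>f' a\<bar> powr q + t * \<bar>f' b\<bar> powr q)
          + ((1 - (1 - t)) * \<bar>f' a\<bar> powr q + (1 - t) * \<bar>f' b\<bar> powr q)"
      using add_mono[OF conv[OF t(1)] conv[OF t(2)]]
      unfolding x_eq[symmetric] mirror_eq[symmetric] .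
    also have "\<dots> = \<bar>f' a\<bar> powr q + \<bar>f' b\<bar> powr q"
      by (simp add: algebra_simps)
    finally show ?thesis
      using add_le_of_powr_add_le[of "\<bar>f' x\<bar>" "\<bar>f' (a + b - x)\<bar>" "\<bar>f' a\<bar>" "\<bar>f' b\<bar>" q] q
      by simp
  qed
  have "\<bar>(1 / h) * integral {a..a + h} f - f ((2 * a + h) / 2)\<bar>
      = \<bar>1 / (b - a) * integral {a..b} f - f ((a + b) / 2)\<bar>"
    by (simp add: h)
  also have "\<dots> \<le> 2 powr (1 / p) * (\<bar>f' a\<bar> + \<bar>f' b\<bar>) * (b - a) / 8"
    using ab assms(10)[unfolded K] sum_bound by (rule midpoint_deviation_bound)
  also have "\<dots> = 2 powr (1 / p) * ((\<bar>f' a\<bar> + \<bar>f' b\<bar>) * h / 8)"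
    by (simp add: h)
  also have "\<dots> \<le> 2 * (4 / (p + 1)) powr (1 / p) * ((\<bar>f' a\<bar> + \<bar>f' b\<bar>) * h / 8)"
    using two_powr_le_twice_four_div_powr[of p] assms(11) \<open>0 < h\<close>
    by (intro mult_right_mono) auto
  finally show ?thesis
    by (simp add: mult_ac)
qed

end
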